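(* Let $n$ be a product of more than two distinct primes, $n=p_1p_2\cdots p_m$ with $m>2$. Let $G_2$ be the induced subgraph of the comaximal graph $\Gamma(\mathbb{Z}_n)$ on the set of nonzero non-units of $\mathbb{Z}_n$. Then the complement $G_2^c$ of $G_2$ is connected.
   Context: The comaximal graph $\Gamma(\mathbb{Z}_n)$ has vertex set $\mathbb{Z}_n=\{0,1,\dots,n-1\}$, distinct $x,y$ adjacent iff $\langle x\rangle+\langle y\rangle=\mathbb{Z}_n$. The non-units of $\mathbb{Z}_n$ are the $a$ with $\gcd(a,n)\neq1$. $G_2^c$ has the same vertices as $G_2$, two distinct vertices adjacent iff they are not adjacent in $G_2$. *)

theory Defs
  imports "HOL-Number_Theory.Residues" "Graph_Theory.Digraph_Component"
begin

text \<open>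
  As in \<^theory>\<open>Graph_Theory.Digraph\<close>, a simple graph is a symmetric loop-free digraph without
  parallel arcs; an edge \<open>{u, v}\<close> is the pair of arcs \<open>(u, v)\<close>, \<open>(v, u)\<close>.
  Accordingly \<^const>\<open>connected\<close> is the usual connectedness; it includes that the
  vertex set is nonempty.
\<close>

definition comaximal_graph :: "('a, 'm) ring_scheme \<Rightarrow> 'a pair_pre_digraph" where
  "comaximal_graph R =
    \<lparr> pverts = carrier R,
      parcs = {(x, y). x \<in> carrier R \<and> y \<in> carrier R \<and> x \<noteq> y \<and>
                 Idl\<^bsub>R\<^esub> {x} <+>\<^bsub>R\<^esub> Idl\<^bsub>R\<^esub> {y} = carrier R} \<rparr>"

definition graph_complement :: "('a, 'b) pre_digraph \<Rightarrow> 'a pair_pre_digraph" where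
  "graph_complement G =
    \<lparr> pverts = verts G,
      parcs = {(u, v). u \<in> verts G \<and> v \<in> verts G \<and> u \<noteq> v \<and> \<not> u \<rightarrow>\<^bsub>G\<^esub> v} \<rparr>"

abbreviation \<Gamma>_Z :: "nat \<Rightarrow> int pair_pre_digraph" where
  "\<Gamma>_Z n \<equiv> comaximal_graph (residue_ring (int n))"

definition nonunits_Z :: "nat \<Rightarrow> int set" where
  "nonunits_Z n = {a \<in> carrier (residue_ring (int n)). gcd a (int n) \<noteq> 1}"

definition G2 :: "nat \<Rightarrow> (int, int \<times> int) pre_digraph" where
  "G2 n = with_proj (\<Gamma>_Z n) \<restriction> (nonunits_Z n - {\<zero>\<^bsub>residue_ring (int n)\<^esub>})"

lemma nonunits_Z_eq:
  assumes "n > 1"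
  shows "nonunits_Z n = carrier (residue_ring (int n)) - Units (residue_ring (int n))"
proof -
  interpret residues "int n" "residue_ring (int n)"
    using assms by unfold_locales auto
  show ?thesis
    using assms unfolding nonunits_Z_def res_units_eq res_carrier_eq
    by (auto simp: coprime_iff_gcd_eq_1 order_le_less)
qed

lemma graph_comaximal_graph:
  assumes "ring R" and "finite (carrier R)"
  shows "graph (with_proj (comaximal_graph R))"
proof -
  interpret ring R by fact
  have comm: "Idl\<^bsub>R\<^esub> {x} <+>\<^bsub>R\<^esub> Idl\<^bsub>R\<^esub> {y} = Idl\<^bsub>R\<^esub> {y} <+>\<^bsub>R\<^esub> Idl\<^bsub>R\<^esub> {x}"
    if "x \<in> carrier R" "y \<in> carrier R" for x y
    using that by (intro set_add_comm ideal.Icarr subsetI) (auto intro: genideal_ideal ideal.Icarr)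
  have "finite (parcs (comaximal_graph R))"
    by (rule finite_subset[of _ "carrier R \<times> carrier R"])
       (use assms in \<open>auto simp: comaximal_graph_def\<close>)
  then show ?thesis
    using assms comm
    by unfold_locales
       (auto simp: comaximal_graph_def arc_to_ends_def symmetric_def sym_def)
qed

lemma graph_graph_complement:
  assumes "graph G"
  shows "graph (with_proj (graph_complement G))"
proof -
  interpret graph G by fact
  have "finite (parcs (graph_complement G))"
    by (rule finite_subset[of _ "verts G \<times> verts G"]) (auto simp: graph_complement_def)
  then show ?thesis
    using sym_arcs
    by unfold_locales
       (auto simp: graph_complement_def arc_to_ends_def symmetric_def sym_def)
qed

end

theory Submission
  imports Defs
begin

text \<open>
  Two vertices divisible by a common prime factor of \<open>n\<close> generate ideals inside the proper ideal of
  multiples of that prime, so they are adjacent in the complement. For vertices \<open>u\<close>, \<open>v\<close> divisible by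
  distinct prime factors \<open>q\<close>, \<open>r\<close>, the product \<open>q r\<close> is a common neighbour (if distinct from both);
  it is a nonzero residue because \<open>n\<close> has a third prime factor.
\<close>

text \<open>If the sum were the whole ring, \<open>1\<close> would be a combination of
  \<open>x\<close> and \<open>y\<close> modulo \<open>m\<close>. As \<open>d\<close> divides
  \<open>x\<close>, \<open>y\<close> and the modulus, it would divide \<open>1\<close>.\<close>

lemma (in residues) genideal_add_neq_carrier:
  fixes d x y :: int
  assumes d: "d dvd m" "\<not> is_unit d"
    and x: "x \<in> carrier R" "d dvd x" and y: "y \<in> carrier R" "d dvd y"
  shows "Idl {x} <+> Idl {y} \<noteq> carrier R"
proof
  assume "Idl {x} <+> Idl {y} = carrier R"
  then have "\<one> \<in> Idl {x} <+> Idl {y}" by simp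
  then obtain a b where "\<one> = (a \<otimes> x) \<oplus> (b \<otimes> y)"
    \<comment> \<open>In a commutative ring the ideal generated by one element consists of its
      multiples, so membership in the sum unfolds to a linear combination.\<close>
    using x y by (auto simp: set_add_def' cgenideal_eq_genideal[symmetric] cgenideal_def)
  then have "1 = (a * x mod m + b * y mod m) mod m"
    by (simp add: res_mult_eq res_add_eq res_one_eq)
  moreover have "d dvd (a * x mod m + b * y mod m) mod m"
    using d x y by (simp add: dvd_mod_iff)
  ultimately show False using d(2) by metis
qed

lemma pverts_complement_G2:
  assumes "n > 1"
  shows "pverts (graph_complement (G2 n)) = {a. 0 < a \<and> a < int n \<and> gcd a (int n) \<noteq> 1}"
proof -
  interpret residues "int n" "residue_ring (int n)"
    using assms by unfold_locales auto
  show ?thesis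
    by (auto simp: graph_complement_def G2_def nonunits_Z_def res_carrier_eq res_zero_eq)
qed

lemma complement_G2_adjI:
  fixes u v d :: int
  assumes n: "n > 1" and d: "d dvd int n" "\<not> is_unit d" "d dvd u" "d dvd v"
    and u: "u \<in> verts (with_proj (graph_complement (G2 n)))"
    and v: "v \<in> verts (with_proj (graph_complement (G2 n)))"
    and "u \<noteq> v"
  shows "u \<rightarrow>\<^bsub>with_proj (graph_complement (G2 n))\<^esub> v"
proof -
  interpret residues "int n" "residue_ring (int n)"
    using n by unfold_locales auto
  have "u \<in> carrier (residue_ring (int n))" "v \<in> carrier (residue_ring (int n))"
    using u v by (auto simp: pverts_complement_G2[OF n] res_carrier_eq)
  then have "\<not> u \<rightarrow>\<^bsub>G2 n\<^esub> v"
    using genideal_add_neq_carrier[OF d(1,2), of u v] d(3,4)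
    by (auto simp: G2_def comaximal_graph_def arcs_ends_conv)
  then show ?thesis
    using u v \<open>u \<noteq> v\<close> by (auto simp: graph_complement_def)
qed

text \<open>The factorization of \<open>n\<close> enters only through these hypotheses:
  \<open>nonempty\<close> yields a vertex, as connectedness demands, and \<open>prod\<close> keeps
  \<open>q * r\<close> strictly between 0 and \<open>n\<close>, so that it is a vertex too.\<close>

lemma connected_complement_G2:
  fixes n :: nat
  assumes nonempty: "\<exists>q. prime q \<and> q dvd n \<and> q < n"
    and prod: "\<And>q r. \<lbrakk>prime q; prime r; q \<noteq> r; q dvd n; r dvd n\<rbrakk> \<Longrightarrow> q * r < n"
  shows "connected (with_proj (graph_complement (G2 n)))"
proof -
  let ?C = "with_proj (graph_complement (G2 n))"
  obtain q0 where q0: "prime q0" "q0 dvd n" "q0 < n" using nonempty by blast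
  have n: "n > 1" using q0 prime_gt_1_nat[of q0] by linarith
  have verts: "a \<in> verts ?C" if "0 < a" "a < int n" "prime q" "int q dvd a" "q dvd n" for a q
  proof -
    have "int q dvd gcd a (int n)" using that by simp
    moreover have "\<not> is_unit (int q)" using prime_gt_1_nat[OF that(3)] by auto
    ultimately have "gcd a (int n) \<noteq> 1" by (intro notI) (simp only:)
    then show ?thesis using that by (simp add: pverts_complement_G2[OF n])
  qed
  have prime_divisor: "\<exists>q. prime q \<and> q dvd n \<and> int q dvd a" if "a \<in> verts ?C" for a
  proof -
    have "0 < a" "gcd a (int n) \<noteq> 1"
      using that by (simp_all add: pverts_complement_G2[OF n])
    moreover from this(1) obtain k where k: "a = int k" by (metis zero_less_imp_eq_int)
    ultimately have "gcd k n \<noteq> 1" by (simp only: gcd_int_int_eq of_nat_eq_1_iff not_False_eq_True)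
    then obtain q where "prime q" "q dvd gcd k n" using prime_factor_nat by blast
    then show ?thesis using k by auto
  qed
  interpret C: wf_digraph ?C
    by unfold_locales (auto simp: graph_complement_def)
  \<comment> \<open>Reachability instead of adjacency allows \<open>u = v\<close>; thus the walk
    through \<open>q * r\<close> below also covers the case where \<open>q * r\<close> is one of its
    ends.\<close>
  have reach: "u \<rightarrow>\<^sup>*\<^bsub>?C\<^esub> v"
    if "u \<in> verts ?C" "v \<in> verts ?C" "prime q" "q dvd n" "int q dvd u" "int q dvd v" for u v q
  proof (cases "u = v")
    case False
    have "\<not> is_unit (int q)" using prime_gt_1_nat[OF that(3)] by auto
    with False show ?thesis
      using complement_G2_adjI[OF n, of "int q" u v] that by auto
  qed (use that in auto)
  have "u \<rightarrow>\<^sup>*\<^bsub>?C\<^esub> v" if u: "u \<in> verts ?C" and v: "v \<in> verts ?C" for u v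
  proof -
    obtain q r where q: "prime q" "q dvd n" "int q dvd u" and r: "prime r" "r dvd n" "int r dvd v"
      using prime_divisor u v by meson
    show ?thesis
    proof (cases "q = r")
      case True
      then show ?thesis using reach[OF u v q] r by simp
    next
      case False
      have w: "int (q * r) \<in> verts ?C"
        using prod[OF q(1) r(1) False q(2) r(2)] q r
          prime_gt_0_nat[of q] prime_gt_0_nat[of r]
        by (intro verts[of _ q]) (simp_all only: of_nat_less_iff of_nat_0_less_iff
            of_nat_dvd_iff nat_0_less_mult_iff dvd_triv_left)
      have "u \<rightarrow>\<^sup>*\<^bsub>?C\<^esub> int (q * r)" "int (q * r) \<rightarrow>\<^sup>*\<^bsub>?C\<^esub> v"
        using reach[OF u w q] reach[OF w v r(1,2)] r by auto
      then show ?thesis by (rule C.reachable_trans)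
    qed
  qed
  moreover have "int q0 \<in> verts ?C"
    using q0 prime_gt_0_nat by (intro verts[of _ q0]) auto
  \<comment> \<open>\<open>connected\<close> means strong connectedness of the symmetric closure, to
    which reachability in \<open>?C\<close> carries over.\<close>
  ultimately show ?thesis
    unfolding connected_def by (intro strongly_connectedI) (auto intro: C.reachable_mk_symmetricI)
qed

theorem theorem5p2:
  fixes n m :: nat and p :: "nat \<Rightarrow> nat"
  assumes "m > 2"
    and "\<And>i. i \<in> {1..m} \<Longrightarrow> prime (p i)"
    and "inj_on p {1..m}"
    and "n = (\<Prod>i = 1..m. p i)"
  shows "connected (with_proj (graph_complement (G2 n)))"
proof -
  have index: "\<exists>i\<in>{1..m}. q = p i" if "prime q" "q dvd n" for q
  proof -
    have "\<exists>i\<in>{1..m}. q dvd p i"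
      using that assms(4) by (simp only: prime_dvd_prod_iff finite_atLeastAtMost)
    then obtain i where i: "i \<in> {1..m}" "q dvd p i" ..
    have "q = p i" by (rule primes_dvd_imp_eq[OF that(1) assms(2)[OF i(1)] i(2)])
    with i(1) show ?thesis ..
  qed
  have "n > 0" using assms(2,4) by (auto simp: prime_gt_0_nat intro!: prod_pos)
  have less: "p i * p j < n" if ij: "i \<in> {1..m}" "j \<in> {1..m}" "i \<noteq> j" for i j
  proof -
    \<comment> \<open>Here \<open>m > 2\<close> provides a third index \<open>k\<close>; the factor
      \<open>p k > 1\<close> makes the inequality strict.\<close>
    have "card ({1..m} - {i, j}) > 0" using ij assms(1) by (simp add: card_Diff_subset)
    then have "{1..m} - {i, j} \<noteq> {}" by (metis card.empty less_irrefl)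
    then obtain k where k: "k \<in> {1..m}" "k \<noteq> i" "k \<noteq> j" by blast
    have "prod p {i, j, k} dvd n"
      unfolding assms(4) using ij k by (intro prod_dvd_prod_subset) auto
    then have le: "p i * p j * p k \<le> n"
      using ij k \<open>n > 0\<close> by (auto simp: mult.assoc dest: dvd_imp_le)
    have "p i * p j * 1 < p i * p j * p k"
      using ij k assms(2) by (intro mult_strict_left_mono mult_pos_pos prime_gt_1_nat prime_gt_0_nat)
    also note le
    finally show ?thesis by simp
  qed
  show ?thesis
  proof (rule connected_complement_G2)
    \<comment> \<open>The prime \<open>p 1\<close> is the witness for a vertex; it lies below
      \<open>n\<close> because already \<open>p 1 * p 2\<close> does.\<close>
    have "p 1 * 1 \<le> p 1 * p 2"
      using assms(1) assms(2)[of 2] prime_gt_0_nat[of "p 2"] by (intro mult_left_mono) auto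
    also have "\<dots> < n" using less[of 1 2] assms(1) by simp
    finally have "p 1 < n" by simp
    moreover have "prime (p 1)" "p 1 dvd n" using assms(1,2,4) by (auto intro: dvd_prodI)
    ultimately show "\<exists>q. prime q \<and> q dvd n \<and> q < n" by blast
  next
    fix q r assume "prime q" "prime r" "q \<noteq> r" "q dvd n" "r dvd n"
    then obtain i j where "i \<in> {1..m}" "j \<in> {1..m}" "q = p i" "r = p j"
      using index by meson
    \<comment> \<open>Distinct primes \<open>q\<close> and \<open>r\<close> have distinct indices,
      as \<open>less\<close> requires.\<close>
    then show "q * r < n" using less[of i j] \<open>q \<noteq> r\<close> by auto
  qed
qed

end
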